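(* Let $p>1$, $\lambda>0$ and $\varphi(x):=\exp(\lambda x_N^2)$ for $x\in D$. Then $$\lim_{\kappa\to+0}T(\kappa\varphi)=(4\lambda)^{-1}.$$
   Context: Let $N\ge1$. Write $x=(x',x_N)$, $\mathbf{R}^N_+=\{x_N>0\}$, $D:=\overline{\mathbf{R}^N_+}$, identifying $\partial\mathbf{R}^N_+$ with $\mathbf{R}^{N-1}$. Let $\Gamma_N(x,t)=(4\pi t)^{-N/2}e^{-|x|^2/(4t)}$, $G(x,y,t):=\Gamma_N(x-y,t)+\Gamma_N(x-y_*,t)$, $y_*=(y',-y_N)$, $[S(t)\mu](x):=\int_DG(x,y,t)\,d\mu(y)$. A nonnegative continuous $u$ on $D\times(0,T)$ is a solution of the initial-boundary problem ($\partial_tu=\Delta u$ in $\mathbf{R}^N_+$, $\partial_\nu u=u^p$ on $\partial\mathbf{R}^N_+$, $u(\cdot,0)=\mu$) in $[0,T)$ if $u(x,t)=[S(t)\mu](x)+\int_0^t\int_{\mathbf{R}^{N-1}}G(x,(y',0),t-s)u(y',0,s)^p\,dy'\,ds$ on $D\times(0,T)$; it is minimal if it lies below every other solution in $[0,T)$. The life span $T(\mu)$ is the maximal existence time of the minimal solution ($T(\mu)=0$ if no solution exists for any $T>0$). *)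

theory Defs
  imports "HOL-Analysis.Analysis" "HOL-Probability.Probability"
begin

text \<open>Points of the closed half space D in R^N are pairs (x', x_N) where
  x' is an extensional function on the index set {..<N-1} (a point of R^(N-1),
  allowing N = 1 where R^0 is a single point) and x_N is real.\<close>

type_synonym pt = "(nat \<Rightarrow> real) \<times> real"

definition bdry_space :: "nat \<Rightarrow> (nat \<Rightarrow> real) measure" where
  "bdry_space N = PiM {..<N-1} (\<lambda>_. lborel)"

definition halfD :: "nat \<Rightarrow> pt set" where
  "halfD N = (PiE {..<N-1} (\<lambda>_. UNIV)) \<times> {0..}"

definition sqd :: "nat \<Rightarrow> (nat \<Rightarrow> real) \<Rightarrow> (nat \<Rightarrow> real) \<Rightarrow> real" where
  "sqd N x' y' = (\<Sum>i<N-1. (x' i - y' i)^2)"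

definition heatG :: "nat \<Rightarrow> real \<Rightarrow> real \<Rightarrow> real" where
  "heatG N r2 t = (4 * pi * t) powr (- real N / 2) * exp (- r2 / (4 * t))"

text \<open>Neumann Green function G(x,y,t) = Gamma_N(x-y,t) + Gamma_N(x-y_*,t).\<close>
definition Gk :: "nat \<Rightarrow> pt \<Rightarrow> pt \<Rightarrow> real \<Rightarrow> real" where
  "Gk N x y t = heatG N (sqd N (fst x) (fst y) + (snd x - snd y)^2) t
              + heatG N (sqd N (fst x) (fst y) + (snd x + snd y)^2) t"

text \<open>[S(t) mu](x) for an initial measure mu with nonnegative density f on D.\<close>
definition Sop :: "nat \<Rightarrow> real \<Rightarrow> (pt \<Rightarrow> real) \<Rightarrow> pt \<Rightarrow> ennreal" where
  "Sop N t f x = (\<integral>\<^sup>+ y'. (\<integral>\<^sup>+ yN. indicator {0..} yN *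
        ennreal (Gk N x (y', yN) t * f (y', yN)) \<partial>lborel) \<partial>bdry_space N)"

definition is_solution :: "nat \<Rightarrow> real \<Rightarrow> (pt \<Rightarrow> real) \<Rightarrow> ereal \<Rightarrow> (pt \<Rightarrow> real \<Rightarrow> real) \<Rightarrow> bool" where
  "is_solution N p f T u \<longleftrightarrow>
     (\<forall>x\<in>halfD N. \<forall>t. 0 < t \<and> ereal t < T \<longrightarrow> 0 \<le> u x t) \<and>
     continuous_on (halfD N \<times> {t. 0 < t \<and> ereal t < T}) (\<lambda>(x, t). u x t) \<and>
     (\<forall>x\<in>halfD N. \<forall>t. 0 < t \<and> ereal t < T \<longrightarrow>
        ennreal (u x t) = Sop N t f x +
          (\<integral>\<^sup>+ s. indicator {0<..<t} s *
             (\<integral>\<^sup>+ y'. ennreal (Gk N x (y', 0) (t - s) * u (y', 0) s powr p) \<partial>bdry_space N)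
           \<partial>lborel))"

definition is_minimal_solution :: "nat \<Rightarrow> real \<Rightarrow> (pt \<Rightarrow> real) \<Rightarrow> ereal \<Rightarrow> (pt \<Rightarrow> real \<Rightarrow> real) \<Rightarrow> bool" where
  "is_minimal_solution N p f T u \<longleftrightarrow> is_solution N p f T u \<and>
     (\<forall>v. is_solution N p f T v \<longrightarrow>
        (\<forall>x\<in>halfD N. \<forall>t. 0 < t \<and> ereal t < T \<longrightarrow> u x t \<le> v x t))"

definition life_span :: "nat \<Rightarrow> real \<Rightarrow> (pt \<Rightarrow> real) \<Rightarrow> ereal" where
  "life_span N p f = Sup (insert 0 {T. 0 < T \<and> (\<exists>u. is_minimal_solution N p f T u)})"

end

theory Submission
  imports Defs
begin

text \<open>The initial datum depends on \<open>x\<^sub>N\<close> only, so integrating the kernels over \<open>R\<^bsup>N-1\<^esup>\<close> reduces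
  everything to one dimension. There \<open>S(t)(\<kappa>\<phi>) = (\<kappa> / sqrt \<theta>) exp (\<lambda> x\<^sub>N\<^sup>2 / \<theta>)\<close> with \<open>\<theta> = 1 - 4\<lambda>t\<close>, which is
  infinite from \<open>t = 1/(4\<lambda>)\<close> on; hence \<open>T(\<kappa>\<phi>) \<le> 1/(4\<lambda>)\<close>. Conversely, fix \<open>T < 1/(4\<lambda>)\<close>. The boundary
  trace \<open>h\<close> of the minimal solution solves the Volterra equation
  \<open>h(t) = a(t) + \<integral>\<^sub>0\<^sup>t h(s)\<^sup>p / sqrt (\<pi>(t-s)) ds\<close> with \<open>a \<le> m/2\<close> on \<open>(0,T)\<close>, where \<open>m\<close> is proportional to
  \<open>\<kappa>\<close>. Since \<open>p > 1\<close>, the constant \<open>m\<close> is a supersolution once \<open>\<kappa>\<close> is small, so the monotone Picard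
  iterates converge below it, and they stay below every other solution.\<close>

section \<open>Reduction to one dimension\<close>

lemma borel_measurable_heatG [measurable]:
  assumes [measurable]: "r \<in> borel_measurable M" "t \<in> borel_measurable M"
  shows "(\<lambda>x. heatG N (r x) (t x)) \<in> borel_measurable M"
  unfolding heatG_def by measurable

lemma heatG_nonneg [simp]: "0 \<le> heatG N r t"
  by (simp add: heatG_def)

text \<open>The heat flow at time \<open>t\<close> is convolution with a Gaussian of variance
  \<open>2 * t\<close>; in this form the total masses come from the theory of normal
  densities.\<close>

lemma heatG_1_eq_normal_density:
  assumes "t > 0"
  shows "heatG 1 ((x - y)\<^sup>2) t = normal_density x (sqrt (2 * t)) y"
proof -
  have "(4 * pi * t) powr - (1 / 2) = 1 / sqrt (4 * pi * t)"
    using assms by (simp add: powr_minus_divide powr_half_sqrt)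
  then show ?thesis
    using assms by (simp add: heatG_def normal_density_def power2_commute[of x y])
qed

lemma heatG_1_zero:
  assumes "t > 0"
  shows "heatG 1 0 t = 1 / sqrt (4 * pi * t)"
  using heatG_1_eq_normal_density[OF assms, of 0 0] assms
  by (simp add: normal_density_def mult_ac)

text \<open>The exponent is additive over coordinates and the prefactor is a power, so the kernel
  factorises. As \<open>r\<close> is arbitrary, the direct and the reflected term share the same
  tangential factor; for \<open>N = 1\<close> that factor is the empty product.\<close>

lemma heatG_split:
  assumes "t > 0" "N \<ge> 1"
  shows "heatG N (sqd N x' y' + r) t
       = (\<Prod>i<N-1. normal_density (x' i) (sqrt (2 * t)) (y' i)) * heatG 1 r t"
proof -
  obtain n where N: "N = Suc n" using assms(2) by (cases N) auto
  have "heatG (Suc n) (sqd (Suc n) x' y' + r) t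
      = (\<Prod>i<n. normal_density (x' i) (sqrt (2 * t)) (y' i)) * heatG 1 r t"
  proof -
    have e: "normal_density (x' i) (sqrt (2 * t)) (y' i)
        = (4 * pi * t) powr (-1/2) * exp (- (x' i - y' i)\<^sup>2 / (4 * t))" for i
      using heatG_1_eq_normal_density[OF assms(1), of "x' i" "y' i"] by (simp add: heatG_def)
    have p: "(4 * pi * t) powr (- real (Suc n) / 2)
        = ((4 * pi * t) powr (-1/2)) ^ n * (4 * pi * t) powr (-1/2)"
    proof -
      have "((4 * pi * t) powr (-1/2)) ^ n = (4 * pi * t) powr (real n * (-1/2))"
        by (rule powr_power) (use assms(1) in simp)
      moreover have "- real (Suc n) / 2 = real n * (-1/2) + (-1/2)" by (simp add: field_simps)
      ultimately show ?thesis by (simp only: powr_add)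
    qed
    have "- (sqd (Suc n) x' y' + r) / (4 * t)
        = (\<Sum>i<n. - (x' i - y' i)\<^sup>2 / (4 * t)) + - r / (4 * t)"
      by (simp add: sqd_def sum_divide_distrib[symmetric] sum_negf diff_divide_distrib)
    then have s: "exp (- (sqd (Suc n) x' y' + r) / (4 * t))
        = (\<Prod>i<n. exp (- (x' i - y' i)\<^sup>2 / (4 * t))) * exp (- r / (4 * t))"
      by (simp only: exp_add exp_sum finite_lessThan)
    show ?thesis
      unfolding e heatG_def s p prod.distrib by simp
  qed
  then show ?thesis by (simp add: N)
qed

lemma nn_integral_normal_density [simp]:
  assumes "\<sigma> > 0"
  shows "(\<integral>\<^sup>+ y. ennreal (normal_density \<mu> \<sigma> y) \<partial>lborel) = 1"
  using assms by (simp add: nn_integral_eq_integral)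

lemma nn_integral_prod_normal_density:
  assumes "\<sigma> > 0"
  shows "(\<integral>\<^sup>+ y'. ennreal (\<Prod>i<N-1. normal_density (x' i) \<sigma> (y' i)) \<partial>bdry_space N) = 1"
proof -
  interpret product_sigma_finite "\<lambda>_::nat. lborel :: real measure" ..
  have "(\<integral>\<^sup>+ y'. ennreal (\<Prod>i<N-1. normal_density (x' i) \<sigma> (y' i)) \<partial>bdry_space N)
      = (\<integral>\<^sup>+ y'. (\<Prod>i<N-1. ennreal (normal_density (x' i) \<sigma> (y' i))) \<partial>bdry_space N)"
    by (simp add: prod_ennreal)
  also have "\<dots> = (\<Prod>i<N-1. \<integral>\<^sup>+ y. ennreal (normal_density (x' i) \<sigma> y) \<partial>lborel)"
    unfolding bdry_space_def by (rule product_nn_integral_prod) auto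
  also have "\<dots> = 1" using assms by simp
  finally show ?thesis .
qed

lemma measurable_prod_normal_density [measurable]:
  "(\<lambda>y'. \<Prod>i<N-1. normal_density (x' i) \<sigma> (y' i)) \<in> borel_measurable (bdry_space N)"
  unfolding bdry_space_def by measurable

lemma Gk_split:
  assumes "t > 0" "N \<ge> 1"
  shows "Gk N x y t = (\<Prod>i<N-1. normal_density (fst x i) (sqrt (2 * t)) (fst y i))
     * (heatG 1 ((snd x - snd y)\<^sup>2) t + heatG 1 ((snd x + snd y)\<^sup>2) t)"
  unfolding Gk_def heatG_split[OF assms] by (simp add: algebra_simps)

lemma Gk_nonneg [simp]: "0 \<le> Gk N x y t"
  by (simp add: Gk_def)

text \<open>A source on the boundary coincides with its mirror image, whence the factor 2; the
  tangential Gaussian has mass one.\<close>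

lemma nn_integral_Gk_boundary:
  assumes "t > 0" "N \<ge> 1" "c \<ge> 0"
  shows "(\<integral>\<^sup>+ y'. ennreal (Gk N x (y', 0) t * c) \<partial>bdry_space N)
       = ennreal (2 * heatG 1 ((snd x)\<^sup>2) t * c)"
proof -
  let ?P = "\<lambda>y'. \<Prod>i<N-1. normal_density (fst x i) (sqrt (2 * t)) (y' i)"
  have P: "(\<lambda>y'. ennreal (?P y')) \<in> borel_measurable (bdry_space N)" by measurable
  have "(\<integral>\<^sup>+ y'. ennreal (Gk N x (y', 0) t * c) \<partial>bdry_space N)
      = (\<integral>\<^sup>+ y'. ennreal (?P y') * ennreal (2 * heatG 1 ((snd x)\<^sup>2) t * c) \<partial>bdry_space N)"
    unfolding Gk_split[OF assms(1,2)] using assms(3)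
    by (intro nn_integral_cong) (simp add: ennreal_mult[symmetric] prod_nonneg mult_ac)
  also have "\<dots> = ennreal (2 * heatG 1 ((snd x)\<^sup>2) t * c)"
    unfolding nn_integral_multc[OF P] using assms(1)
    by (subst nn_integral_prod_normal_density) auto
  finally show ?thesis .
qed

lemma Sop_eq_half_line:
  assumes "t > 0" "N \<ge> 1" and [measurable]: "g \<in> borel_measurable borel" and "\<And>y. g y \<ge> 0"
  shows "Sop N t (\<lambda>y. g (snd y)) x = (\<integral>\<^sup>+ y. indicator {0..} y *
     ennreal ((heatG 1 ((snd x - y)\<^sup>2) t + heatG 1 ((snd x + y)\<^sup>2) t) * g y) \<partial>lborel)"
    (is "_ = ?R")
proof -
  let ?P = "\<lambda>y'. \<Prod>i<N-1. normal_density (fst x i) (sqrt (2 * t)) (y' i)"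
  have P: "(\<lambda>y'. ennreal (?P y')) \<in> borel_measurable (bdry_space N)" by measurable
  have "(\<integral>\<^sup>+ yN. indicator {0..} yN * ennreal (Gk N x (y', yN) t * g yN) \<partial>lborel)
      = ennreal (?P y') * ?R" for y'
  proof -
    have "(\<integral>\<^sup>+ yN. indicator {0..} yN * ennreal (Gk N x (y', yN) t * g yN) \<partial>lborel)
        = (\<integral>\<^sup>+ yN. ennreal (?P y') * (indicator {0..} yN *
     ennreal ((heatG 1 ((snd x - yN)\<^sup>2) t + heatG 1 ((snd x + yN)\<^sup>2) t) * g yN)) \<partial>lborel)"
      unfolding Gk_split[OF assms(1,2)] using assms(4)
      by (intro nn_integral_cong)
        (simp add: ennreal_mult[symmetric] prod_nonneg mult_ac indicator_def)
    also have "\<dots> = ennreal (?P y') * ?R"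
      by (rule nn_integral_cmult) measurable
    finally show ?thesis .
  qed
  then have "Sop N t (\<lambda>y. g (snd y)) x = (\<integral>\<^sup>+ y'. ennreal (?P y') * ?R \<partial>bdry_space N)"
    by (simp add: Sop_def)
  also have "\<dots> = ?R"
    unfolding nn_integral_multc[OF P] using assms(1)
    by (subst nn_integral_prod_normal_density) auto
  finally show ?thesis .
qed

section \<open>Even reflection and the evolution of the Gaussian-type datum\<close>

lemma nn_integral_half_line_reflect:
  fixes f :: "real \<Rightarrow> real"
  assumes [measurable]: "f \<in> borel_measurable borel" and "\<And>y. f y \<ge> 0"
  shows "(\<integral>\<^sup>+ y. indicator {0..} y * ennreal (f y + f (- y)) \<partial>lborel)
       = (\<integral>\<^sup>+ y. ennreal (f y) \<partial>lborel)"
proof -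
  have "(\<integral>\<^sup>+ y. indicator {0..} y * ennreal (f y + f (- y)) \<partial>lborel)
      = (\<integral>\<^sup>+ y. indicator {0..} y * ennreal (f y) + indicator {0..} y * ennreal (f (- y)) \<partial>lborel)"
    using assms(2) by (intro nn_integral_cong) (simp add: ennreal_plus distrib_left)
  also have "\<dots> = (\<integral>\<^sup>+ y. indicator {0..} y * ennreal (f y) \<partial>lborel)
      + (\<integral>\<^sup>+ y. indicator {0..} y * ennreal (f (- y)) \<partial>lborel)"
    by (rule nn_integral_add) measurable
  also have "(\<integral>\<^sup>+ y. indicator {0..} y * ennreal (f (- y)) \<partial>lborel)
      = (\<integral>\<^sup>+ y. indicator {..0} y * ennreal (f y) \<partial>lborel)"
    by (subst nn_integral_real_affine[of _ "-1" 0])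
      (auto simp: indicator_def intro!: nn_integral_cong)
  also have "(\<integral>\<^sup>+ y. indicator {0..} y * ennreal (f y) \<partial>lborel)
      + (\<integral>\<^sup>+ y. indicator {..0} y * ennreal (f y) \<partial>lborel)
      = (\<integral>\<^sup>+ y. indicator {0..} y * ennreal (f y) + indicator {..0} y * ennreal (f y) \<partial>lborel)"
    by (rule nn_integral_add[symmetric]) measurable
  \<comment> \<open>The two closed half lines overlap in the point 0, which is counted twice but is
    a null set.\<close>
  also have "\<dots> = (\<integral>\<^sup>+ y. ennreal (f y) \<partial>lborel)"
    using AE_lborel_singleton[of "0::real"]
    by (intro nn_integral_cong_AE) (auto elim!: eventually_mono simp: indicator_def)
  finally show ?thesis .
qed

text \<open>Method of images: the Neumann flow of an even datum is the free heat flow on the whole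
  line, since the reflected kernel accounts for the other half.\<close>

lemma Sop_even:
  assumes "t > 0" "N \<ge> 1" and [measurable]: "g \<in> borel_measurable borel" and "\<And>y. g y \<ge> 0"
    and "\<And>y. g (- y) = g y"
  shows "Sop N t (\<lambda>y. g (snd y)) x
       = (\<integral>\<^sup>+ y. ennreal (heatG 1 ((snd x - y)\<^sup>2) t * g y) \<partial>lborel)"
proof -
  have "(\<integral>\<^sup>+ y. ennreal (heatG 1 ((snd x - y)\<^sup>2) t * g y) \<partial>lborel)
      = (\<integral>\<^sup>+ y. indicator {0..} y * ennreal (heatG 1 ((snd x - y)\<^sup>2) t * g y
          + heatG 1 ((snd x - (- y))\<^sup>2) t * g (- y)) \<partial>lborel)"
    using assms(4) by (intro nn_integral_half_line_reflect[symmetric]) auto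
  then show ?thesis
    unfolding Sop_eq_half_line[OF assms(1-4)] by (simp add: assms(5) distrib_right)
qed

text \<open>Heat kernel times datum is again a Gaussian in \<open>y\<close>, with mean
  \<open>X / \<theta>\<close> and variance \<open>2 * t / \<theta>\<close>. The condition
  \<open>\<theta> > 0\<close> says that the decay of the kernel beats the growth of the
  datum.\<close>

lemma complete_square:
  fixes t lam \<theta> X y :: real
  assumes "t > 0" "\<theta> > 0" "\<theta> = 1 - 4 * lam * t"
  shows "- (X - y)\<^sup>2 / (4 * t) + lam * y\<^sup>2
       = lam * X\<^sup>2 / \<theta> + - (y - X / \<theta>)\<^sup>2 / (2 * (2 * t / \<theta>))"
proof -
  have "4 * t * \<theta> * (- (X - y)\<^sup>2 / (4 * t) + lam * y\<^sup>2) = \<theta> * (4 * lam * t * y\<^sup>2 - (X - y)\<^sup>2)"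
    using assms(1) by (simp add: field_simps)
  also have "\<dots> = 4 * lam * t * X\<^sup>2 - (\<theta> * y - X)\<^sup>2"
    unfolding assms(3) by algebra
  also have "(\<theta> * y - X)\<^sup>2 = \<theta>\<^sup>2 * (y - X / \<theta>)\<^sup>2"
    using assms(2) by (simp add: power_mult_distrib[symmetric] right_diff_distrib)
  also have "4 * lam * t * X\<^sup>2 - \<theta>\<^sup>2 * Z
      = 4 * t * \<theta> * (lam * X\<^sup>2 / \<theta> + - Z / (2 * (2 * t / \<theta>)))" for Z
    using assms(1,2) by (simp add: field_simps power2_eq_square)
  finally show ?thesis using assms(1,2) by simp
qed

text \<open>After completing the square the integrand is a constant times a normal density. The
  factor \<open>1 / sqrt \<theta>\<close> in that constant is the ratio of the normalisations for
  the variances \<open>2 * t\<close> and \<open>2 * t / \<theta>\<close>.\<close>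

lemma Sop_exp_square:
  assumes "t > 0" "N \<ge> 1" "\<kappa> \<ge> 0" "4 * lam * t < 1"
  shows "Sop N t (\<lambda>y. \<kappa> * exp (lam * (snd y)\<^sup>2)) x
       = ennreal (\<kappa> / sqrt (1 - 4 * lam * t) * exp (lam * (snd x)\<^sup>2 / (1 - 4 * lam * t)))"
proof -
  define \<theta> where "\<theta> = 1 - 4 * lam * t"
  have \<theta>: "\<theta> > 0" using assms by (simp add: \<theta>_def)
  let ?C = "\<kappa> / sqrt \<theta> * exp (lam * (snd x)\<^sup>2 / \<theta>)"
  let ?f = "\<lambda>y. ?C * normal_density (snd x / \<theta>) (sqrt (2 * t / \<theta>)) y"
  have eq: "heatG 1 ((snd x - y)\<^sup>2) t * (\<kappa> * exp (lam * y\<^sup>2)) = ?f y" for y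
  proof -
    have "- (snd x - y)\<^sup>2 / (4 * t) + lam * y\<^sup>2
        = lam * (snd x)\<^sup>2 / \<theta> + - (y - snd x / \<theta>)\<^sup>2 / (2 * (2 * t / \<theta>))"
      using assms(1) \<theta> by (rule complete_square) (rule \<theta>_def)
    then have E: "exp (- (snd x - y)\<^sup>2 / (4 * t)) * exp (lam * y\<^sup>2)
        = exp (lam * (snd x)\<^sup>2 / \<theta>) * exp (- (y - snd x / \<theta>)\<^sup>2 / (2 * (2 * t / \<theta>)))"
      by (simp add: exp_add[symmetric])
    have "heatG 1 ((snd x - y)\<^sup>2) t = 1 / sqrt (4 * pi * t) * exp (- (snd x - y)\<^sup>2 / (4 * t))"
      using heatG_1_zero[OF assms(1)] by (simp add: heatG_def)
    then have "heatG 1 ((snd x - y)\<^sup>2) t * (\<kappa> * exp (lam * y\<^sup>2))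
        = \<kappa> / sqrt (4 * pi * t) * (exp (- (snd x - y)\<^sup>2 / (4 * t)) * exp (lam * y\<^sup>2))"
      by simp
    also have "\<dots> = ?f y"
      unfolding E using assms(1) \<theta>
      by (simp add: normal_density_def) (simp add: real_sqrt_divide real_sqrt_mult)
    finally show ?thesis .
  qed
  have "Sop N t (\<lambda>y. \<kappa> * exp (lam * (snd y)\<^sup>2)) x
      = (\<integral>\<^sup>+ y. ennreal (heatG 1 ((snd x - y)\<^sup>2) t * (\<kappa> * exp (lam * y\<^sup>2))) \<partial>lborel)"
    using assms by (intro Sop_even) auto
  also have "\<dots> = (\<integral>\<^sup>+ y. ennreal (?f y) \<partial>lborel)"
    by (simp only: eq)
  also have "\<dots> = (\<integral>\<^sup>+ y. ennreal ?C * ennreal (normal_density (snd x / \<theta>) (sqrt (2 * t / \<theta>)) y) \<partial>lborel)"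
    using assms \<theta> by (intro nn_integral_cong) (simp add: ennreal_mult[symmetric])
  also have "\<dots> = ennreal ?C"
    using assms(1) \<theta> by (subst nn_integral_cmult) auto
  finally show ?thesis by (simp add: \<theta>_def)
qed

text \<open>Once the growth rate \<open>lam\<close> reaches \<open>1 / (4 * t)\<close>, the
  integrand at a boundary point is bounded below by its value at \<open>y = 0\<close>, a positive
  constant, on the whole line.\<close>

lemma Sop_exp_square_infinite:
  assumes "t > 0" "N \<ge> 1" "\<kappa> > 0" "4 * lam * t \<ge> 1" "snd x = 0"
  shows "Sop N t (\<lambda>y. \<kappa> * exp (lam * (snd y)\<^sup>2)) x = \<infinity>"
proof -
  define c where "c = \<kappa> / sqrt (4 * pi * t)"
  have c: "c > 0" using assms by (simp add: c_def)
  have ge: "c \<le> heatG 1 (y\<^sup>2) t * (\<kappa> * exp (lam * y\<^sup>2))" for y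
  proof -
    have "heatG 1 (y\<^sup>2) t * (\<kappa> * exp (lam * y\<^sup>2)) = c * exp (- y\<^sup>2 / (4 * t) + lam * y\<^sup>2)"
      using heatG_1_zero[OF assms(1)] unfolding exp_add by (simp add: heatG_def c_def)
    moreover have "- y\<^sup>2 / (4 * t) + lam * y\<^sup>2 = y\<^sup>2 * (4 * lam * t - 1) / (4 * t)"
      using assms(1) by (simp add: field_simps)
    ultimately show ?thesis using assms c by simp
  qed
  have "(\<infinity>::ennreal) = (\<integral>\<^sup>+ y. ennreal c \<partial>(lborel :: real measure))"
    using c by (simp add: ennreal_mult_top)
  also have "\<dots> \<le> (\<integral>\<^sup>+ y. ennreal (heatG 1 ((snd x - y)\<^sup>2) t * (\<kappa> * exp (lam * y\<^sup>2))) \<partial>lborel)"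
    using ge by (intro nn_integral_mono ennreal_leI) (simp add: assms(5))
  also have "\<dots> = Sop N t (\<lambda>y. \<kappa> * exp (lam * (snd y)\<^sup>2)) x"
    using assms by (intro Sop_even[symmetric]) auto
  finally show ?thesis by (simp add: top.extremum_unique)
qed

text \<open>A solution is real valued and dominates \<open>Sop\<close>. If \<open>T\<close> exceeded
  \<open>1 / (4 * lam)\<close>, that critical time would itself be admissible, yet
  \<open>Sop\<close> is infinite there.\<close>

lemma life_span_exp_square_le:
  assumes "N \<ge> 1" "\<kappa> > 0" "lam > 0"
  shows "life_span N p (\<lambda>x. \<kappa> * exp (lam * (snd x)\<^sup>2)) \<le> ereal (1 / (4 * lam))"
  unfolding life_span_def
proof (rule Sup_least)
  fix T
  assume T: "T \<in> insert 0 {T. 0 < T \<and> (\<exists>u. is_minimal_solution N p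
                (\<lambda>x. \<kappa> * exp (lam * (snd x)\<^sup>2)) T u)}"
  show "T \<le> ereal (1 / (4 * lam))"
  proof (rule ccontr)
    assume "\<not> T \<le> ereal (1 / (4 * lam))"
    then have lt: "ereal (1 / (4 * lam)) < T" by simp
    moreover have pos: "1 / (4 * lam) > 0" using assms by simp
    ultimately have "T \<noteq> 0" by auto
    with T obtain u where "is_solution N p (\<lambda>x. \<kappa> * exp (lam * (snd x)\<^sup>2)) T u"
      by (auto simp: is_minimal_solution_def)
    \<comment> \<open>The origin of the boundary; the value \<open>undefined\<close> off the index
      set makes its first component extensional, as \<open>halfD\<close> demands.\<close>
    moreover define x :: pt where "x = ((\<lambda>i. if i < N - 1 then 0 else undefined), 0)"
    have "x \<in> halfD N" by (auto simp: x_def halfD_def PiE_def extensional_def)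
    ultimately have "ennreal (u x (1 / (4 * lam)))
        \<ge> Sop N (1 / (4 * lam)) (\<lambda>x. \<kappa> * exp (lam * (snd x)\<^sup>2)) x"
      using lt pos unfolding is_solution_def by simp
    moreover have "Sop N (1 / (4 * lam)) (\<lambda>x. \<kappa> * exp (lam * (snd x)\<^sup>2)) x = \<infinity>"
      using assms pos by (intro Sop_exp_square_infinite) (auto simp: x_def)
    ultimately show False by (simp add: top_unique)
  qed
qed

section \<open>The layer potential\<close>

text \<open>The boundary kernel integrated over the tangential variables. Extension by zero outside
  \<open>0 < s < t\<close> lets every time integral run over the whole line.\<close>

definition layer :: "real \<Rightarrow> real \<Rightarrow> real \<Rightarrow> real" where
  "layer x t s = (if 0 < s \<and> s < t then 2 * heatG 1 (x\<^sup>2) (t - s) else 0)"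

lemma layer_nonneg [simp]: "0 \<le> layer x t s"
  by (simp add: layer_def)

lemma borel_measurable_layer [measurable]:
  assumes [measurable]: "f \<in> borel_measurable M" "g \<in> borel_measurable M" "h \<in> borel_measurable M"
  shows "(\<lambda>z. layer (f z) (g z) (h z)) \<in> borel_measurable M"
  unfolding layer_def by measurable

lemma layer_le: "layer x t s \<le> layer 0 t s"
  by (auto simp: layer_def heatG_def mult_left_le)

text \<open>Reversing time moves the singularity from \<open>s = t\<close> to the fixed point 0,
  where one dominating function can serve all \<open>t\<close> in a bounded range.\<close>

lemma nn_integral_layer_reflect:
  "(\<integral>\<^sup>+ s. ennreal (layer x t s) \<partial>lborel) = (\<integral>\<^sup>+ s. ennreal (layer x t (t - s)) \<partial>lborel)"
  by (subst nn_integral_real_affine[of _ "-1" t]) auto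

lemma nn_integral_layer_0:
  assumes "t \<ge> 0"
  shows "(\<integral>\<^sup>+ s. ennreal (layer 0 t s) \<partial>lborel) = ennreal (2 * sqrt (t / pi))"
proof -
  \<comment> \<open>At \<open>s = t\<close> the kernel is cut off while the closed indicator is not,
    so this one point is excluded. At \<open>s = 0\<close> both sides vanish because
    \<open>0 powr (-1/2) = 0\<close>.\<close>
  have eq: "layer 0 t (t - s) = 1 / sqrt pi * (indicator {0..t} s * s powr (-1/2))" if "s \<noteq> t" for s
  proof (cases "0 < s \<and> s < t")
    case True
    then show ?thesis
      using heatG_1_zero[of s]
      by (simp add: layer_def real_sqrt_mult powr_minus_divide powr_half_sqrt)
  next
    case False
    then show ?thesis using that by (auto simp: layer_def indicator_def)
  qed
  have "(\<integral>\<^sup>+ s. ennreal (layer 0 t s) \<partial>lborel)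
      = (\<integral>\<^sup>+ s. ennreal (1 / sqrt pi) * ennreal (indicator {0..t} s * s powr (-1/2)) \<partial>lborel)"
    unfolding nn_integral_layer_reflect
    using AE_lborel_singleton[of t]
    by (intro nn_integral_cong_AE) (auto elim!: eventually_mono simp: eq ennreal_mult[symmetric])
  also have "\<dots> = ennreal (1 / sqrt pi) * (\<integral>\<^sup>+ s. ennreal (indicator {0..t} s * s powr (-1/2)) \<partial>lborel)"
    by (rule nn_integral_cmult) measurable
  also have "(\<integral>\<^sup>+ s. ennreal (indicator {0..t} s * s powr (-1/2)) \<partial>lborel) = ennreal (t powr (1/2) / (1/2))"
    using has_integral_powr_from_0[of "-1/2" t] assms
    by (intro nn_integral_has_integral_lebesgue) auto
  also have "ennreal (1 / sqrt pi) * ennreal (t powr (1/2) / (1/2)) = ennreal (2 * sqrt (t / pi))"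
    using assms by (simp add: ennreal_mult[symmetric] powr_half_sqrt real_sqrt_divide)
  finally show ?thesis .
qed

section \<open>Integrability and continuity of the layer kernel\<close>

lemma integrable_layer [intro, simp]:
  "integrable lborel (layer x t)"
proof (rule integrableI_nonneg)
  have "(\<integral>\<^sup>+ s. ennreal (layer x t s) \<partial>lborel) \<le> (\<integral>\<^sup>+ s. ennreal (layer 0 \<bar>t\<bar> s) \<partial>lborel)"
    by (intro nn_integral_mono ennreal_leI) (auto simp: layer_def heatG_def mult_left_le)
  also have "\<dots> < \<infinity>" by (subst nn_integral_layer_0) auto
  finally show "(\<integral>\<^sup>+ s. ennreal (layer x t s) \<partial>lborel) < \<infinity>" .
qed auto

lemma integral_layer_0:
  assumes "t \<ge> 0"
  shows "(\<integral> s. layer 0 t s \<partial>lborel) = 2 * sqrt (t / pi)"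
  using nn_integral_layer_0[OF assms] assms by (subst integral_eq_nn_integral) auto

lemma tendsto_heatG_1:
  assumes "X \<longlonglongrightarrow> x" "S \<longlonglongrightarrow> s" "s > 0"
  shows "(\<lambda>n. heatG 1 ((X n)\<^sup>2) (S n)) \<longlonglongrightarrow> heatG 1 (x\<^sup>2) s"
  unfolding heatG_def using assms(3) by (intro tendsto_intros assms) auto

lemma tendsto_layer:
  assumes "X \<longlonglongrightarrow> x" "T \<longlonglongrightarrow> t" "s \<noteq> t"
  shows "(\<lambda>n. layer (X n) (T n) s) \<longlonglongrightarrow> layer x t s"
proof (cases "s < t")
  case True
  then have ev: "eventually (\<lambda>n. s < T n) sequentially" using assms(2) by (simp add: order_tendstoD)
  have "(\<lambda>n. if 0 < s then 2 * heatG 1 ((X n)\<^sup>2) (T n - s) else 0)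
      \<longlonglongrightarrow> (if 0 < s then 2 * heatG 1 (x\<^sup>2) (t - s) else 0)"
    using True by (auto simp del: One_nat_def intro!: tendsto_intros tendsto_heatG_1 assms)
  then have "(\<lambda>n. layer (X n) (T n) s) \<longlonglongrightarrow> (if 0 < s then 2 * heatG 1 (x\<^sup>2) (t - s) else 0)"
    by (rule Lim_transform_eventually) (use ev in eventually_elim, simp add: layer_def)
  also have "(if 0 < s then 2 * heatG 1 (x\<^sup>2) (t - s) else 0) = layer x t s"
    using True by (simp add: layer_def)
  finally show ?thesis .
next
  case False
  then have "eventually (\<lambda>n. T n < s) sequentially" using assms by (simp add: order_tendstoD)
  then have "eventually (\<lambda>n. layer (X n) (T n) s = 0) sequentially"
    by eventually_elim (simp add: layer_def)
  then show ?thesis using False by (simp add: layer_def tendsto_eventually)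
qed

text \<open>With time reversed, all kernels lie below the one for \<open>x = 0\<close> and a common
  bound \<open>B\<close> of the times, whose mass is finite; dominated convergence applies.\<close>

lemma tendsto_nn_integral_layer:
  assumes "X \<longlonglongrightarrow> x" "T \<longlonglongrightarrow> t"
  shows "(\<lambda>n. \<integral>\<^sup>+ s. ennreal (layer (X n) (T n) s) \<partial>lborel)
       \<longlonglongrightarrow> (\<integral>\<^sup>+ s. ennreal (layer x t s) \<partial>lborel)"
proof -
  obtain B where B: "\<And>n. \<bar>T n\<bar> \<le> B"
    using convergent_imp_Bseq[OF convergentI[OF assms(2)]] by (auto simp: Bseq_def)
  have "0 \<le> B" using B[of 0] by simp
  have lim: "(\<lambda>n. layer (X n) (T n) (T n - s)) \<longlonglongrightarrow> layer x t (t - s)" if "s \<noteq> t" for s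
  proof (cases "s < t")
    case True
    then have ev: "eventually (\<lambda>n. s < T n) sequentially" using assms(2) by (simp add: order_tendstoD)
    have "(\<lambda>n. if 0 < s then 2 * heatG 1 ((X n)\<^sup>2) s else 0)
        \<longlonglongrightarrow> (if 0 < s then 2 * heatG 1 (x\<^sup>2) s else 0)"
      by (auto simp del: One_nat_def intro!: tendsto_intros tendsto_heatG_1 assms)
    then have "(\<lambda>n. layer (X n) (T n) (T n - s)) \<longlonglongrightarrow> (if 0 < s then 2 * heatG 1 (x\<^sup>2) s else 0)"
      by (rule Lim_transform_eventually) (use ev in eventually_elim, simp add: layer_def)
    also have "(if 0 < s then 2 * heatG 1 (x\<^sup>2) s else 0) = layer x t (t - s)"
      using True by (simp add: layer_def)
    finally show ?thesis .
  next
    case False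
    then have "eventually (\<lambda>n. T n < s) sequentially" using assms that by (simp add: order_tendstoD)
    then have "eventually (\<lambda>n. layer (X n) (T n) (T n - s) = 0) sequentially"
      by eventually_elim (simp add: layer_def)
    then show ?thesis using False by (simp add: layer_def tendsto_eventually)
  qed
  show ?thesis
    unfolding nn_integral_layer_reflect
  proof (rule nn_integral_dominated_convergence[where w = "\<lambda>s. ennreal (layer 0 B (B - s))"])
    show "(\<integral>\<^sup>+ s. ennreal (layer 0 B (B - s)) \<partial>lborel) < \<infinity>"
      using \<open>0 \<le> B\<close> by (simp add: nn_integral_layer_reflect[symmetric] nn_integral_layer_0)
    show "AE s in lborel. ennreal (layer (X n) (T n) (T n - s)) \<le> ennreal (layer 0 B (B - s))" for n
      using B[of n] by (intro AE_I2 ennreal_leI) (auto simp: layer_def heatG_def mult_left_le)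
    show "AE s in lborel. (\<lambda>n. ennreal (layer (X n) (T n) (T n - s))) \<longlonglongrightarrow> ennreal (layer x t (t - s))"
      using AE_lborel_singleton[of t] by (auto elim!: eventually_mono intro: lim)
  qed measurable
qed

lemma integrable_layer_mult:
  assumes [measurable]: "g \<in> borel_measurable borel" and "\<And>s. 0 < s \<Longrightarrow> s < t \<Longrightarrow> \<bar>g s\<bar> \<le> M"
  shows "integrable lborel (\<lambda>s. layer x t s * g s)"
proof (rule Bochner_Integration.integrable_bound)
  show "integrable lborel (\<lambda>s. M * layer x t s)" by simp
  show "AE s in lborel. norm (layer x t s * g s) \<le> norm (M * layer x t s)"
  proof (rule AE_I2)
    fix s
    show "norm (layer x t s * g s) \<le> norm (M * layer x t s)"
      using assms(2)[of s] by (cases "0 < s \<and> s < t") (auto simp: layer_def abs_mult mult_mono' mult.commute)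
  qed
qed measurable

text \<open>The singularity of the kernel moves with \<open>t\<close>, which rules out a dominating function;
  Scheffe's lemma gives convergence of the kernels in mean instead.\<close>
lemma continuous_layer_potential:
  assumes [measurable]: "g \<in> borel_measurable borel" and bd: "\<And>s. \<bar>g s\<bar> \<le> M"
  shows "continuous_on UNIV (\<lambda>(x, t). \<integral> s. layer x t s * g s \<partial>lborel)"
proof (unfold continuous_on_sequentially, intro ballI allI impI)
  fix Z :: "nat \<Rightarrow> real \<times> real" and z
  assume "(\<forall>n. Z n \<in> UNIV) \<and> Z \<longlonglongrightarrow> z"
  moreover define X T x t where "X = fst \<circ> Z" and "T = snd \<circ> Z" and "x = fst z" and "t = snd z"
  ultimately have X: "X \<longlonglongrightarrow> x" and T: "T \<longlonglongrightarrow> t"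
    by (auto simp: comp_def intro: tendsto_fst tendsto_snd)
  define d where "d n = (\<integral> s. \<bar>layer (X n) (T n) s - layer x t s\<bar> \<partial>lborel)" for n
  have "(\<lambda>n. \<integral>\<^sup>+ s. norm (layer (X n) (T n) s - layer x t s) \<partial>lborel) \<longlonglongrightarrow> 0"
  proof (rule Scheffe_lemma1)
    show "AE s in lborel. (\<lambda>n. layer (X n) (T n) s) \<longlonglongrightarrow> layer x t s"
      using AE_lborel_singleton[of t] by (auto elim!: eventually_mono intro: tendsto_layer X T)
    \<comment> \<open>Convergence of the total masses is what upgrades pointwise convergence of the
      kernels to convergence in L1.\<close>
    show "limsup (\<lambda>n. \<integral>\<^sup>+ s. norm (layer (X n) (T n) s) \<partial>lborel)
        \<le> (\<integral>\<^sup>+ s. norm (layer x t s) \<partial>lborel)"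
      using lim_imp_Limsup[OF _ tendsto_nn_integral_layer[OF X T]] by simp
  qed auto
  moreover have "(\<integral>\<^sup>+ s. norm (layer (X n) (T n) s - layer x t s) \<partial>lborel) = ennreal (d n)" for n
    unfolding d_def by (subst nn_integral_eq_integral) auto
  moreover have d0: "d n \<ge> 0" for n by (simp add: d_def)
  ultimately have "(\<lambda>n. ennreal (d n)) \<longlonglongrightarrow> ennreal 0" by simp
  then have d: "d \<longlonglongrightarrow> 0" using d0 by (subst (asm) tendsto_ennreal_iff) auto
  have int: "integrable lborel (\<lambda>s. layer x t s * g s)" for x t
    using bd by (intro integrable_layer_mult) auto
  have "norm ((\<integral> s. layer (X n) (T n) s * g s \<partial>lborel) - (\<integral> s. layer x t s * g s \<partial>lborel)) \<le> d n * M" for n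
  proof -
    have "norm ((\<integral> s. layer (X n) (T n) s * g s \<partial>lborel) - (\<integral> s. layer x t s * g s \<partial>lborel))
        = norm (\<integral> s. (layer (X n) (T n) s - layer x t s) * g s \<partial>lborel)"
      using int by (simp add: left_diff_distrib)
    also have "\<dots> \<le> (\<integral> s. \<bar>layer (X n) (T n) s - layer x t s\<bar> * M \<partial>lborel)"
    proof (rule Bochner_Integration.integral_norm_bound_integral)
      show "integrable lborel (\<lambda>s. (layer (X n) (T n) s - layer x t s) * g s)"
        using int by (simp add: left_diff_distrib)
    qed (auto simp: abs_mult intro!: mult_left_mono bd)
    finally show ?thesis by (simp add: d_def)
  qed
  then have "(\<lambda>n. (\<integral> s. layer (X n) (T n) s * g s \<partial>lborel) - (\<integral> s. layer x t s * g s \<partial>lborel)) \<longlonglongrightarrow> 0"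
    by (intro Lim_null_comparison[OF always_eventually tendsto_mult_left_zero[OF d, of M]]) simp
  then have "(\<lambda>n. \<integral> s. layer (X n) (T n) s * g s \<partial>lborel) \<longlonglongrightarrow> (\<integral> s. layer x t s * g s \<partial>lborel)"
    by (rule LIM_zero_cancel)
  then show "((\<lambda>(x, t). \<integral> s. layer x t s * g s \<partial>lborel) \<circ> Z)
      \<longlonglongrightarrow> (case z of (x, t) \<Rightarrow> \<integral> s. layer x t s * g s \<partial>lborel)"
    by (simp only: X_def T_def x_def t_def comp_def case_prod_beta)
qed

section \<open>The boundary Volterra equation\<close>

text \<open>The single-layer heat potential of the flux \<open>w powr p\<close>, for a boundary
  trace \<open>w\<close> depending on time only.\<close>

definition potential :: "real \<Rightarrow> (real \<Rightarrow> real) \<Rightarrow> real \<Rightarrow> real \<Rightarrow> real" where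
  "potential p w x t = (\<integral> s. layer x t s * w s powr p \<partial>lborel)"

text \<open>Starting from zero puts the iteration below every nonnegative solution, which later
  yields minimality.\<close>

primrec picard :: "real \<Rightarrow> (real \<Rightarrow> real) \<Rightarrow> nat \<Rightarrow> real \<Rightarrow> real" where
  "picard p a 0 = (\<lambda>_. 0)"
| "picard p a (Suc n) = (\<lambda>t. a t + potential p (picard p a n) 0 t)"

lemma borel_measurable_potential [measurable]:
  assumes [measurable]: "w \<in> borel_measurable borel"
  shows "potential p w x \<in> borel_measurable borel"
  unfolding potential_def by measurable

section \<open>Bounds and monotonicity of the potential\<close>

lemma powr_bounded_on:
  fixes w :: "real \<Rightarrow> real"
  assumes "\<And>s. 0 < s \<Longrightarrow> s < t \<Longrightarrow> 0 \<le> w s \<and> w s \<le> m" "p > 0" "0 < s" "s < t"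
  shows "\<bar>w s powr p\<bar> \<le> m powr p"
  using assms(1)[OF assms(3,4)] assms(2) by (simp add: powr_mono2)

lemma integrable_potential:
  assumes "w \<in> borel_measurable borel" "\<And>s. 0 < s \<Longrightarrow> s < t \<Longrightarrow> 0 \<le> w s \<and> w s \<le> m" "p > 0"
  shows "integrable lborel (\<lambda>s. layer x t s * w s powr p)"
  using assms powr_bounded_on[OF assms(2,3)] by (intro integrable_layer_mult) auto

lemma potential_nonneg: "0 \<le> potential p w x t"
  by (simp add: potential_def)

lemma nn_integral_potential:
  assumes "w \<in> borel_measurable borel" "\<And>s. 0 < s \<Longrightarrow> s < t \<Longrightarrow> 0 \<le> w s \<and> w s \<le> m" "p > 0"
  shows "(\<integral>\<^sup>+ s. ennreal (layer x t s * w s powr p) \<partial>lborel) = ennreal (potential p w x t)"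
  unfolding potential_def using integrable_potential[OF assms]
  by (intro nn_integral_eq_integral) auto

lemma layer_mult_mono:
  assumes "0 < s \<Longrightarrow> s < t \<Longrightarrow> c \<le> d"
  shows "layer x t s * c \<le> layer x t s * d"
  using assms by (auto simp: layer_def mult_left_mono)

text \<open>The upper bound \<open>m\<close> secures integrability; a Bochner integral that does not
  exist is 0 by default and would spoil the comparison.\<close>

lemma potential_mono:
  assumes "w \<in> borel_measurable borel" "w' \<in> borel_measurable borel" "p > 0"
    "\<And>s. 0 < s \<Longrightarrow> s < t \<Longrightarrow> 0 \<le> w s \<and> w s \<le> w' s \<and> w' s \<le> m"
  shows "potential p w x t \<le> potential p w' x t"
  unfolding potential_def
proof (rule integral_mono)
  show "integrable lborel (\<lambda>s. layer x t s * w s powr p)"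
    using assms by (intro integrable_potential[where m = m]) force+
  show "integrable lborel (\<lambda>s. layer x t s * w' s powr p)"
    using assms by (intro integrable_potential[where m = m]) force+
qed (use assms in \<open>auto intro!: layer_mult_mono powr_mono2\<close>)

text \<open>The kernel is largest at \<open>x = 0\<close>, where its mass is
  \<open>2 * sqrt (t / pi)\<close>, and the flux is at most \<open>m powr p\<close>.\<close>

lemma potential_le:
  assumes "w \<in> borel_measurable borel" "\<And>s. 0 < s \<Longrightarrow> s < t \<Longrightarrow> 0 \<le> w s \<and> w s \<le> m" "p > 0" "t \<ge> 0"
  shows "potential p w x t \<le> m powr p * (2 * sqrt (t / pi))"
proof -
  have "potential p w x t \<le> (\<integral> s. layer 0 t s * m powr p \<partial>lborel)"
    unfolding potential_def
  proof (rule integral_mono)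
    show "integrable lborel (\<lambda>s. layer x t s * w s powr p)"
      using assms(1-3) by (rule integrable_potential)
    show "layer x t s * w s powr p \<le> layer 0 t s * m powr p" for s
    proof -
      have "layer x t s * w s powr p \<le> layer x t s * m powr p"
        using assms by (intro layer_mult_mono powr_mono2) auto
      also have "\<dots> \<le> layer 0 t s * m powr p" by (intro mult_right_mono layer_le) auto
      finally show ?thesis .
    qed
  qed auto
  also have "\<dots> = m powr p * (2 * sqrt (t / pi))"
    using integral_layer_0[OF assms(4)] by simp
  finally show ?thesis .
qed

text \<open>The budget \<open>m\<close> is shared equally: one half bounds the linear term
  \<open>a\<close>, the other the potential of the constant \<open>m\<close> up to time
  \<open>T\<close>. Hence the Picard map preserves the range from 0 to \<open>m\<close>.\<close>

locale volterra =
  fixes p T m :: real and a :: "real \<Rightarrow> real"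
  assumes p: "p > 0" and measurable_a [measurable]: "a \<in> borel_measurable borel"
    and a_bounds: "\<And>t. 0 < t \<Longrightarrow> t < T \<Longrightarrow> 0 \<le> a t \<and> a t \<le> m / 2"
    and small: "m powr p * (2 * sqrt (T / pi)) \<le> m / 2"
begin

section \<open>Monotone iteration for the boundary trace\<close>

lemma measurable_picard [measurable]: "picard p a n \<in> borel_measurable borel"
  by (induction n) auto

lemma picard_bounds:
  assumes "0 < t" "t < T"
  shows "0 \<le> picard p a n t \<and> picard p a n t \<le> m"
  using assms
proof (induction n arbitrary: t)
  case 0
  then show ?case using a_bounds[OF 0] by simp
next
  case (Suc n)
  have "potential p (picard p a n) 0 t \<le> m powr p * (2 * sqrt (t / pi))"
    using Suc p by (intro potential_le) auto
  also have "\<dots> \<le> m powr p * (2 * sqrt (T / pi))"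
    using Suc.prems by (intro mult_left_mono) (auto simp: divide_right_mono)
  finally show ?case
    using small a_bounds[OF Suc.prems] potential_nonneg[of p "picard p a n" 0 t] by simp
qed

text \<open>The Picard map is order preserving and its first step from zero goes upwards.\<close>

lemma picard_mono:
  assumes "0 < t" "t < T"
  shows "picard p a n t \<le> picard p a (Suc n) t"
  using assms
proof (induction n arbitrary: t)
  case 0
  then show ?case using a_bounds[OF 0] potential_nonneg by simp
next
  case (Suc n)
  have "potential p (picard p a n) 0 t \<le> potential p (picard p a (Suc n)) 0 t"
    using Suc p picard_bounds by (intro potential_mono[where m = m]) (auto simp del: picard.simps)
  then show ?case by simp
qed

text \<open>Convergence is established for \<open>0 < t < T\<close> only. Taking \<open>lim\<close>
  at every \<open>t\<close> nevertheless gives a function measurable on the whole line.\<close>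

definition profile :: "real \<Rightarrow> real" where
  "profile t = lim (\<lambda>n. picard p a n t)"

lemma measurable_profile [measurable]: "profile \<in> borel_measurable borel"
  unfolding profile_def by measurable

lemma picard_tendsto:
  assumes "0 < t" "t < T"
  shows "(\<lambda>n. picard p a n t) \<longlonglongrightarrow> profile t"
proof -
  have "incseq (\<lambda>n. picard p a n t)"
    using picard_mono[OF assms] by (intro incseq_SucI)
  moreover have "\<forall>n. \<bar>picard p a n t\<bar> \<le> m" using picard_bounds[OF assms] by simp
  ultimately have "convergent (\<lambda>n. picard p a n t)"
    by (intro Bseq_mono_convergent BseqI') (auto simp: incseq_def)
  then show ?thesis unfolding profile_def by (simp add: convergent_LIMSEQ_iff)
qed

lemma profile_bounds:
  assumes "0 < t" "t < T"
  shows "0 \<le> profile t \<and> profile t \<le> m"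
  using picard_tendsto[OF assms] picard_bounds[OF assms]
  by (meson LIMSEQ_le_const LIMSEQ_le_const2)

text \<open>Dominated convergence with the integrable bound \<open>layer x t s * m powr p\<close>.
  The case \<open>x = 0\<close> gives the fixed point equation, general \<open>x\<close> the passage
  to the limit in the half space.\<close>

lemma potential_picard_tendsto:
  assumes "0 < t" "t < T"
  shows "(\<lambda>n. potential p (picard p a n) x t) \<longlonglongrightarrow> potential p profile x t"
  unfolding potential_def
proof (rule integral_dominated_convergence)
  show "integrable lborel (\<lambda>s. layer x t s * m powr p)" by simp
  show "AE s in lborel. norm (layer x t s * picard p a n s powr p) \<le> layer x t s * m powr p" for n
    using assms picard_bounds p
    by (intro AE_I2) (auto simp: abs_mult intro!: layer_mult_mono powr_mono2)
  have "(\<lambda>n. layer x t s * picard p a n s powr p) \<longlonglongrightarrow> layer x t s * profile s powr p" for s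
  proof (cases "0 < s \<and> s < t")
    case True
    then show ?thesis using assms p picard_bounds
      by (intro tendsto_intros tendsto_powr' picard_tendsto) auto
  qed (auto simp: layer_def)
  then show "AE s in lborel. (\<lambda>n. layer x t s * picard p a n s powr p) \<longlonglongrightarrow> layer x t s * profile s powr p"
    by simp
qed measurable

lemma profile_fixed_point:
  assumes "0 < t" "t < T"
  shows "profile t = a t + potential p profile 0 t"
proof (rule LIMSEQ_unique)
  show "(\<lambda>n. picard p a (Suc n) t) \<longlonglongrightarrow> profile t"
    using picard_tendsto[OF assms] by (rule LIMSEQ_Suc)
  show "(\<lambda>n. picard p a (Suc n) t) \<longlonglongrightarrow> a t + potential p profile 0 t"
    using tendsto_add[OF tendsto_const potential_picard_tendsto[OF assms]] by simp
qed

lemma continuous_potential_profile: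
  "continuous_on (UNIV \<times> {0<..<T}) (\<lambda>(x, t). potential p profile x t)"
proof -
  \<comment> \<open>Truncation makes the flux globally bounded. For \<open>t < T\<close> it goes
    unnoticed, since the kernel sees only \<open>s\<close> between 0 and \<open>t\<close>.\<close>
  define g where "g s = (if 0 < s \<and> s < T then profile s powr p else 0)" for s
  have [measurable]: "g \<in> borel_measurable borel" unfolding g_def by measurable
  have "\<bar>g s\<bar> \<le> m powr p" for s
    using profile_bounds[of s] p by (auto simp: g_def powr_mono2)
  then have "continuous_on UNIV (\<lambda>(x, t). \<integral> s. layer x t s * g s \<partial>lborel)"
    by (intro continuous_layer_potential) auto
  then have "continuous_on (UNIV \<times> {0<..<T}) (\<lambda>(x, t). \<integral> s. layer x t s * g s \<partial>lborel)"
    by (rule continuous_on_subset) auto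
  moreover have "(\<integral> s. layer x t s * g s \<partial>lborel) = potential p profile x t" if "t < T" for x t
    unfolding potential_def using that
    by (intro Bochner_Integration.integral_cong) (auto simp: layer_def g_def)
  ultimately show ?thesis
    by (subst continuous_on_cong[OF refl]) auto
qed

text \<open>The nonlinearity acts on the boundary alone, so the trace \<open>profile\<close>
  determines the solution in the half space through the representation formula. Minimality passes
  from the iterates to their limit.\<close>

lemma exists_minimal_solution:
  assumes "N \<ge> 1"
    and Sop: "\<And>x t. 0 < t \<Longrightarrow> t < T \<Longrightarrow> Sop N t f x = ennreal (A (snd x) t)"
    and A: "continuous_on (UNIV \<times> {0<..<T}) (\<lambda>(r, t). A r t)"
    and A_nonneg: "\<And>r t. 0 < t \<Longrightarrow> t < T \<Longrightarrow> 0 \<le> A r t"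
    and A_0: "\<And>t. 0 < t \<Longrightarrow> t < T \<Longrightarrow> A 0 t = a t"
  shows "\<exists>u. is_minimal_solution N p f (ereal T) u"
proof
  define u :: "pt \<Rightarrow> real \<Rightarrow> real" where "u x t = A (snd x) t + potential p profile (snd x) t" for x t
  \<comment> \<open>The fixed point equation closes the loop: the trace of \<open>u\<close> is the
    very flux profile from which \<open>u\<close> was built.\<close>
  have boundary: "u (y', 0) s = profile s" if "0 < s" "s < T" for y' s
    using profile_fixed_point[OF that] A_0[OF that] by (simp add: u_def)
  have layer_eq: "indicator {0<..<t} s *
        (\<integral>\<^sup>+ y'. ennreal (Gk N x (y', 0) (t - s) * w s powr p) \<partial>bdry_space N)
      = ennreal (layer (snd x) t s * w s powr p)" for x t s w
    using nn_integral_Gk_boundary[of "t - s" N "w s powr p" x] \<open>N \<ge> 1\<close>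
    by (auto simp: layer_def indicator_def)
  have "is_solution N p f (ereal T) u"
    unfolding is_solution_def
  proof (intro conjI ballI allI impI)
    fix x t assume "x \<in> halfD N" and "0 < t \<and> ereal t < ereal T"
    then have t: "0 < t" "t < T" by auto
    show "0 \<le> u x t"
      using A_nonneg[OF t] potential_nonneg by (simp add: u_def)
    have "(\<integral>\<^sup>+ s. indicator {0<..<t} s *
        (\<integral>\<^sup>+ y'. ennreal (Gk N x (y', 0) (t - s) * u (y', 0) s powr p) \<partial>bdry_space N) \<partial>lborel)
      = (\<integral>\<^sup>+ s. indicator {0<..<t} s *
        (\<integral>\<^sup>+ y'. ennreal (Gk N x (y', 0) (t - s) * profile s powr p) \<partial>bdry_space N) \<partial>lborel)"
      using t by (intro nn_integral_cong) (simp add: indicator_def boundary)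
    also have "\<dots> = ennreal (potential p profile (snd x) t)"
      unfolding layer_eq using t profile_bounds p by (intro nn_integral_potential[where m = m]) auto
    finally show "ennreal (u x t) = Sop N t f x + (\<integral>\<^sup>+ s. indicator {0<..<t} s *
        (\<integral>\<^sup>+ y'. ennreal (Gk N x (y', 0) (t - s) * u (y', 0) s powr p) \<partial>bdry_space N) \<partial>lborel)"
      using A_nonneg[OF t] potential_nonneg by (simp add: u_def Sop[OF t] ennreal_plus)
  next
    have "continuous_on (UNIV \<times> {0<..<T}) (\<lambda>(r, t). A r t + potential p profile r t)"
      using continuous_on_add[OF A continuous_potential_profile] by (simp add: case_prod_beta)
    then have "continuous_on (halfD N \<times> {t. 0 < t \<and> ereal t < ereal T})
        (\<lambda>z. (\<lambda>(r, t). A r t + potential p profile r t) (snd (fst z), snd z))"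
      by (rule continuous_on_compose2) (auto intro!: continuous_intros)
    then show "continuous_on (halfD N \<times> {t. 0 < t \<and> ereal t < ereal T}) (\<lambda>(x, t). u x t)"
      by (simp add: u_def case_prod_beta)
  qed
  moreover have "u x t \<le> v x t"
    if v: "is_solution N p f (ereal T) v" and x: "x \<in> halfD N" and t: "0 < t" "t < T" for v x t
  proof -
    \<comment> \<open>One use of the integral equation for \<open>v\<close> carries a lower bound on
      the boundary to all of the half space. As \<open>v\<close> may depend on \<open>y'\<close>,
      the comparison takes place under the boundary integral, and only the iterate's side is then
      reduced to one dimension.\<close>
    have step: "A (snd x) t + potential p (picard p a n) (snd x) t \<le> v x t"
      if lower: "\<And>y' s. y' \<in> PiE {..<N-1} (\<lambda>_. UNIV) \<Longrightarrow> 0 < s \<Longrightarrow> s < T \<Longrightarrow> picard p a n s \<le> v (y', 0) s"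
        and x: "x \<in> halfD N" and t: "0 < t" "t < T" for n x t
    proof -
      let ?J = "\<lambda>w. \<integral>\<^sup>+ s. indicator {0<..<t} s *
          (\<integral>\<^sup>+ y'. ennreal (Gk N x (y', 0) (t - s) * w y' s powr p) \<partial>bdry_space N) \<partial>lborel"
      have "?J (\<lambda>_. picard p a n) \<le> ?J (\<lambda>y'. v (y', 0))"
      proof (rule nn_integral_mono)
        fix s
        have "(\<integral>\<^sup>+ y'. ennreal (Gk N x (y', 0) (t - s) * picard p a n s powr p) \<partial>bdry_space N)
            \<le> (\<integral>\<^sup>+ y'. ennreal (Gk N x (y', 0) (t - s) * v (y', 0) s powr p) \<partial>bdry_space N)"
          if s: "0 < s" "s < t"
        proof (intro nn_integral_mono ennreal_leI mult_left_mono powr_mono2)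
          fix y' assume "y' \<in> space (bdry_space N)"
          then show "picard p a n s \<le> v (y', 0) s"
            using s \<open>t < T\<close> by (intro lower) (auto simp: bdry_space_def space_PiM)
        qed (use s \<open>t < T\<close> p picard_bounds in auto)
        then show "indicator {0<..<t} s *
            (\<integral>\<^sup>+ y'. ennreal (Gk N x (y', 0) (t - s) * picard p a n s powr p) \<partial>bdry_space N)
            \<le> indicator {0<..<t} s *
            (\<integral>\<^sup>+ y'. ennreal (Gk N x (y', 0) (t - s) * v (y', 0) s powr p) \<partial>bdry_space N)"
          by (cases "s \<in> {0<..<t}") auto
      qed
      then have "Sop N t f x + ?J (\<lambda>_. picard p a n) \<le> Sop N t f x + ?J (\<lambda>y'. v (y', 0))"
        by (rule add_left_mono)
      also have "\<dots> = ennreal (v x t)"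
        using v x t unfolding is_solution_def by simp
      also have "?J (\<lambda>_. picard p a n) = ennreal (potential p (picard p a n) (snd x) t)"
        unfolding layer_eq using t picard_bounds p
        by (intro nn_integral_potential[where m = m]) auto
      also have "Sop N t f x + ennreal (potential p (picard p a n) (snd x) t)
          = ennreal (A (snd x) t + potential p (picard p a n) (snd x) t)"
        using A_nonneg[OF t] potential_nonneg by (simp add: Sop[OF t] ennreal_plus)
      finally have "ennreal (A (snd x) t + potential p (picard p a n) (snd x) t) \<le> ennreal (v x t)" .
      moreover have "0 \<le> v x t" using v x t unfolding is_solution_def by simp
      ultimately show ?thesis by (simp add: ennreal_le_iff)
    qed
    have "picard p a n s \<le> v (y', 0) s"
      if "y' \<in> PiE {..<N-1} (\<lambda>_. UNIV)" "0 < s" "s < T" for n y' s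
      using that
    proof (induction n arbitrary: y' s)
      case 0
      then show ?case using v unfolding is_solution_def halfD_def by simp
    next
      case (Suc n)
      have "A (snd (y', 0)) s + potential p (picard p a n) (snd (y', 0)) s \<le> v (y', 0) s"
        using Suc by (intro step) (auto simp: halfD_def)
      then show ?case using A_0 Suc.prems by simp
    qed
    then have "A (snd x) t + potential p (picard p a n) (snd x) t \<le> v x t" for n
      using x t by (intro step) auto
    moreover have "(\<lambda>n. A (snd x) t + potential p (picard p a n) (snd x) t) \<longlonglongrightarrow> u x t"
      unfolding u_def by (intro tendsto_intros potential_picard_tendsto t)
    ultimately show ?thesis by (intro LIMSEQ_le_const2) auto
  qed
  ultimately show "is_minimal_solution N p f (ereal T) u"
    by (auto simp: is_minimal_solution_def)
qed

end

section \<open>The life span\<close>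

text \<open>On the boundary the linear term increases in time and stays below its value at
  \<open>T\<close>, which is \<open>m / 2\<close>; this explains the choice of \<open>m\<close>. As
  \<open>4 * lam * T < 1\<close>, the denominators stay positive.\<close>

lemma life_span_exp_square_ge:
  fixes N :: nat and p lam \<kappa> T :: real
  assumes "N \<ge> 1" "p > 0" "lam > 0" "\<kappa> > 0" "0 < T" "4 * lam * T < 1"
  defines "m \<equiv> 2 * \<kappa> / sqrt (1 - 4 * lam * T)"
  assumes small: "m powr p * (2 * sqrt (T / pi)) \<le> m / 2"
  shows "ereal T \<le> life_span N p (\<lambda>x. \<kappa> * exp (lam * (snd x)\<^sup>2))"
proof -
  define A where "A r t = \<kappa> / sqrt (1 - 4 * lam * t) * exp (lam * r\<^sup>2 / (1 - 4 * lam * t))" for r t :: real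
  have lt: "4 * lam * t < 4 * lam * T" if "t < T" for t
    using that assms by simp
  interpret volterra p T m "A 0"
  proof
    fix t assume t: "0 < t" "t < T"
    have pos: "0 < 1 - 4 * lam * t" using lt[OF t(2)] assms(6) by linarith
    then have "\<kappa> / sqrt (1 - 4 * lam * t) \<le> \<kappa> / sqrt (1 - 4 * lam * T)"
      using lt[OF t(2)] assms(4,6) by (intro divide_left_mono mult_pos_pos) auto
    then show "0 \<le> A 0 t \<and> A 0 t \<le> m / 2"
      using pos assms(4) by (simp add: A_def m_def)
  next
    show "A 0 \<in> borel_measurable borel" unfolding A_def by measurable
  qed (use assms(2) small in auto)
  have "\<exists>u. is_minimal_solution N p (\<lambda>x. \<kappa> * exp (lam * (snd x)\<^sup>2)) (ereal T) u"
  proof (rule exists_minimal_solution)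
    show "Sop N t (\<lambda>x. \<kappa> * exp (lam * (snd x)\<^sup>2)) x = ennreal (A (snd x) t)" if "0 < t" "t < T" for x t
      unfolding A_def using that lt[OF that(2)] assms(1,4,6) by (intro Sop_exp_square) auto
    have "1 - 4 * lam * snd z \<noteq> 0" if "z \<in> UNIV \<times> {0<..<T}" for z :: "real \<times> real"
      using lt[of "snd z"] that assms(6) by auto
    then show "continuous_on (UNIV \<times> {0<..<T}) (\<lambda>(r, t). A r t)"
      unfolding A_def case_prod_beta by (intro continuous_intros) auto
    show "0 \<le> A r t" if "0 < t" "t < T" for r t
      using lt[OF that(2)] assms(4,6) by (simp add: A_def)
  qed (use assms in auto)
  then show ?thesis
    unfolding life_span_def using \<open>0 < T\<close> by (intro Sup_upper) auto
qed

theorem theorem6p8: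
  fixes N :: nat and p lam :: real
  assumes "N \<ge> 1" and "p > 1" and "lam > 0"
  shows "((\<lambda>\<kappa>. life_span N p (\<lambda>x. \<kappa> * exp (lam * (snd x)^2)))
            \<longlongrightarrow> ereal (1 / (4 * lam))) (at_right 0)"
proof (rule order_tendstoI)
  fix b assume b: "ereal (1 / (4 * lam)) < b"
  show "\<forall>\<^sub>F \<kappa> in at_right 0. life_span N p (\<lambda>x. \<kappa> * exp (lam * (snd x)^2)) < b"
    using eventually_at_right_less[of "0::real"]
    by eventually_elim (use life_span_exp_square_le[OF assms(1) _ assms(3)] b in \<open>auto intro: le_less_trans\<close>)
next
  fix b assume "b < ereal (1 / (4 * lam))"
  \<comment> \<open>Taking the maximum with 0 yields a real \<open>T\<close> that is positive and
    above \<open>b\<close>, even when \<open>b\<close> is negative or minus infinity.\<close>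
  then have "max b 0 < ereal (1 / (4 * lam))" using assms by simp
  then obtain T where T: "max b 0 < ereal T" "ereal T < ereal (1 / (4 * lam))"
    using ereal_dense2 by blast
  then have T': "0 < T" "b < ereal T" "4 * lam * T < 1"
    using assms by (auto simp: field_simps)
  define m where "m \<kappa> = 2 * \<kappa> / sqrt (1 - 4 * lam * T)" for \<kappa>
  have "(m \<longlongrightarrow> 0) (at_right 0)"
    unfolding m_def using T'(3) by (auto intro!: tendsto_eq_intros)
  moreover have m_pos: "m \<kappa> > 0" if "\<kappa> > 0" for \<kappa> using that T' by (simp add: m_def)
  \<comment> \<open>Dividing the smallness condition by \<open>m \<kappa>\<close> leaves the power
    \<open>p - 1\<close>. Since \<open>p > 1\<close>, this power is continuous at 0, so the
    condition holds for all small \<open>\<kappa>\<close>.\<close>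
  ultimately have "((\<lambda>\<kappa>. m \<kappa> powr (p - 1) * (2 * sqrt (T / pi))) \<longlongrightarrow> 0 powr (p - 1) * (2 * sqrt (T / pi))) (at_right 0)"
    using assms eventually_at_right_less[of "0::real"]
    by (intro tendsto_intros tendsto_powr') (auto elim!: eventually_mono intro: less_imp_le)
  then have "\<forall>\<^sub>F \<kappa> in at_right 0. m \<kappa> powr (p - 1) * (2 * sqrt (T / pi)) < 1 / 2"
    by (rule order_tendstoD) simp
  then show "\<forall>\<^sub>F \<kappa> in at_right 0. b < life_span N p (\<lambda>x. \<kappa> * exp (lam * (snd x)^2))"
    using eventually_at_right_less[of "0::real"]
  proof eventually_elim
    case (elim \<kappa>)
    have "m \<kappa> powr p * (2 * sqrt (T / pi)) = m \<kappa> * (m \<kappa> powr (p - 1) * (2 * sqrt (T / pi)))"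
      using m_pos[of \<kappa>] elim by (simp add: powr_diff)
    also have "\<dots> \<le> m \<kappa> * (1 / 2)"
      using m_pos[of \<kappa>] elim by (intro mult_left_mono) auto
    finally have "ereal T \<le> life_span N p (\<lambda>x. \<kappa> * exp (lam * (snd x)^2))"
      using assms T' elim by (intro life_span_exp_square_ge) (auto simp: m_def)
    then show ?case using T'(2) by (rule less_le_trans[rotated])
  qed
qed

end
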